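(* Let $R$ be a commutative ring with identity and let $a$ be a non-unit element of $R$. (1) Suppose $(0:a) \subseteq (a)$, and let $I$ be an ideal of $R$ with $I(a) \subseteq (a)^{2}$. Then $(a)$ is $I$-prime if and only if $(a)$ is prime. Now let $(R, m)$ be a quasi-local ring. Then: (2) For an ideal $I$ of $R$ with $I(a) \subseteq (a)^{3}$, $(a)$ is $I$-prime if and only if $(a)$ is $0$-prime. (3) $(a)$ is $m$-prime if and only if $a$ is irreducible.
   Context: All rings are commutative with identity. For an ideal $I$ of a ring $R$, a proper ideal $P$ of $R$ is called $I$-prime if for all $x, y \in R$, $xy \in P - IP$ (that is, $xy \in P$ and $xy \notin IP$) implies $x \in P$ or $y \in P$. "$0$-prime" is the case where $I$ is the zero ideal (equivalently, weakly prime: $0 \neq xy \in P$ implies $x \in P$ or $y \in P$). $(a)$ is the principal ideal generated by $a$, and $(0:a) = \{r \in R : ra = 0\}$. A quasi-local ring $(R,m)$ is a (not necessarily Noetherian) ring with unique maximal ideal $m$. A non-unit $a$ is irreducible if $a = xy$ with $x, y \in R$ implies $x \in (a)$ or $y \in (a)$. The hypothesis $(0:a) \subseteq (a)$ applies only to part (1), and the quasi-local hypothesis only to parts (2) and (3).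
   Formalization: In part (3), when a = 0 the ring R is additionally assumed to be a domain; for a = 0 in a quasi-local ring that is not a domain (e.g. Z/4), (0) is vacuously m-prime but 0 is not irreducible, so the equivalence fails. *)

theory Defs
  imports "HOL-Algebra.Algebra"
begin

definition I_prime :: "('a, 'b) ring_scheme \<Rightarrow> 'a set \<Rightarrow> 'a set \<Rightarrow> bool"
  where "I_prime R I P \<longleftrightarrow>
    ideal P R \<and> P \<noteq> carrier R \<and>
    (\<forall>x\<in>carrier R. \<forall>y\<in>carrier R. x \<otimes>\<^bsub>R\<^esub> y \<in> P - I \<cdot>\<^bsub>R\<^esub> P \<longrightarrow> x \<in> P \<or> y \<in> P)"

definition annihilator :: "('a, 'b) ring_scheme \<Rightarrow> 'a \<Rightarrow> 'a set"
  where "annihilator R a = {r \<in> carrier R. r \<otimes>\<^bsub>R\<^esub> a = \<zero>\<^bsub>R\<^esub>}"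

locale quasi_local = cring R + maximalideal m R for R (structure) and m +
  assumes unique_maximal: "maximalideal M R \<Longrightarrow> M = m"

(* Not the library's irreducible / ring_irreducible, which differ from this notion in rings with
   zero divisors. The element a may be zero: then a is irreducible iff the ring is a domain. *)
definition irreducible_element :: "('a, 'b) ring_scheme \<Rightarrow> 'a \<Rightarrow> bool"
  where "irreducible_element R a \<longleftrightarrow>
    a \<in> carrier R \<and> a \<notin> Units R \<and>
    (\<forall>x\<in>carrier R. \<forall>y\<in>carrier R. a = x \<otimes>\<^bsub>R\<^esub> y \<longrightarrow> x \<in> PIdl\<^bsub>R\<^esub> a \<or> y \<in> PIdl\<^bsub>R\<^esub> a)"

end

theory Submission
  imports Defs
begin

text \<open>
  The engine is one observation about an \<open>I\<close>-prime ideal \<open>P\<close>. If \<open>x \<otimes> y\<close> lies in \<open>P\<close> with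
  neither factor in \<open>P\<close>, then the same is true of \<open>x \<otimes> (y \<oplus> p)\<close> for every \<open>p\<close> in \<open>P\<close>; both
  products therefore lie in \<open>I \<cdot> P\<close>, and so does their difference \<open>x \<otimes> p\<close>. Hence
  \<open>x \<otimes> P \<subseteq> I \<cdot> P\<close>, and shifting both factors gives \<open>P \<cdot> P \<subseteq> I \<cdot> P\<close>: an \<open>I\<close>-prime ideal that
  fails to be prime has its square inside \<open>I \<cdot> P\<close> (\<open>I_prime_shift\<close> and
  \<open>I_prime_not_prime_square\<close>).

  Take \<open>P = (a)\<close>. If \<open>I(a) \<subseteq> (a)\<^sup>2\<close> and \<open>x\<close> is such a factor, then \<open>xa = ra\<^sup>2\<close> for some \<open>r\<close>, so
  \<open>x - ra\<close> annihilates \<open>a\<close>. When the annihilator of \<open>a\<close> lies in \<open>(a)\<close>, this puts \<open>x\<close> in \<open>(a)\<close>,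
  a contradiction; so \<open>(a)\<close> is prime.

  If \<open>I(a) \<subseteq> (a)\<^sup>3\<close> and \<open>(a)\<close> is \<open>I\<close>-prime but not prime, then \<open>a\<^sup>2\<close> is a multiple of
  \<open>a\<^sup>3\<close>. In a quasi-local ring a fixed point of multiplication by an element of \<open>m\<close> is zero
  (Nakayama for principal modules), so \<open>a\<^sup>2 = 0\<close>; then \<open>I(a)\<close> is zero and being \<open>I\<close>-prime is
  the same as being \<open>0\<close>-prime.

  Finally, for \<open>a \<noteq> 0\<close>, the set \<open>(a) - m(a)\<close> consists exactly of the unit multiples of \<open>a\<close>. So
  being \<open>m\<close>-prime constrains only the factorizations of unit multiples of \<open>a\<close>, that is, of \<open>a\<close>
  itself, and this is irreducibility. For \<open>a = 0\<close> that set is empty, so \<open>(a)\<close> is \<open>m\<close>-prime, and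
  \<open>a\<close> is irreducible because the ring is then a domain.
\<close>

section \<open>Principal ideals\<close>

lemma cgenideal_mem_iff: "x \<in> PIdl\<^bsub>R\<^esub> a \<longleftrightarrow> (\<exists>r\<in>carrier R. x = r \<otimes>\<^bsub>R\<^esub> a)"
  unfolding cgenideal_def by blast

context cring
begin

lemma cgenideal_proper:
  assumes "a \<in> carrier R" "a \<notin> Units R"
  shows "PIdl a \<noteq> carrier R"
proof
  assume "PIdl a = carrier R"
  then obtain r where "r \<in> carrier R" "\<one> = r \<otimes> a"
    using one_closed cgenideal_mem_iff by metis
  then have "a \<in> Units R"
    using assms(1) m_comm unfolding Units_def by force
  with assms(2) show False by simp
qed

text \<open>Sums of products collapse because the second factor has a single generator.\<close>

lemma ideal_prod_cgenideal:
  assumes J: "ideal J R" and a: "a \<in> carrier R"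
  shows "J \<cdot> (PIdl a) = {j \<otimes> a | j. j \<in> J}"
proof (intro equalityI subsetI)
  interpret J: ideal J R by fact
  fix s assume "s \<in> J \<cdot> (PIdl a)"
  then show "s \<in> {j \<otimes> a | j. j \<in> J}"
  proof (induct s rule: ideal_prod.induct)
    case (prod i p)
    then obtain r where r: "r \<in> carrier R" "p = r \<otimes> a"
      using cgenideal_mem_iff by metis
    have "i \<otimes> p = (i \<otimes> r) \<otimes> a" "i \<otimes> r \<in> J"
      using r prod a by (simp_all add: m_assoc J.I_r_closed)
    then show ?case by blast
  next
    case (sum s1 s2)
    then obtain i j where ij: "i \<in> J" "s1 = i \<otimes> a" "j \<in> J" "s2 = j \<otimes> a" by blast
    then have "s1 \<oplus> s2 = (i \<oplus> j) \<otimes> a" "i \<oplus> j \<in> J"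
      using a by (simp_all add: l_distr)
    then show ?case by blast
  qed
next
  fix s assume "s \<in> {j \<otimes> a | j. j \<in> J}"
  then obtain j where j: "j \<in> J" "s = j \<otimes> a" by blast
  show "s \<in> J \<cdot> (PIdl a)"
    unfolding j(2) by (rule ideal_prod.prod[OF j(1) cgenideal_self[OF a]])
qed

lemma zero_ideal_prod:
  assumes "ideal J R"
  shows "{\<zero>} \<cdot> J = {\<zero>}"
  using ideal_prod_commute[OF zeroideal assms] ideal_prod_zero[OF assms] by simp

lemma cgenideal_one: "PIdl \<one> = carrier R"
  unfolding cgenideal_def by force

lemma cgenideal_power:
  assumes a: "a \<in> carrier R"
  shows "(PIdl a) [^]\<^bsub>ideals_set R\<^esub> (n::nat) = PIdl (a [^] n)"
proof (induct n)
  case 0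
  then show ?case by (simp add: cgenideal_one) (simp add: ideals_set_def)
next
  case (Suc n)
  have "(PIdl (a [^] n)) \<cdot> (PIdl a) = PIdl (a [^] n \<otimes> a)"
    unfolding ideal_prod_cgenideal[OF cgenideal_ideal[OF nat_pow_closed[OF a]] a]
    using a by (force simp: cgenideal_def m_assoc)
  moreover have "(PIdl a) [^]\<^bsub>ideals_set R\<^esub> Suc n = ((PIdl a) [^]\<^bsub>ideals_set R\<^esub> n) \<cdot> (PIdl a)"
    by (simp add: ideals_set_def)
  ultimately show ?case using Suc by simp
qed

section \<open>Relatively prime ideals\<close>

lemma primeideal_imp_I_prime:
  assumes "primeideal P R"
  shows "I_prime R I P"
proof -
  interpret primeideal P R by fact
  show ?thesis
    unfolding I_prime_def using ideal_axioms I_notcarr I_prime by blast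
qed

text \<open>A larger subtracted set \<open>I \<cdot> P\<close> leaves fewer products to test.\<close>

lemma I_prime_mono:
  assumes "I_prime R I P" "I \<cdot> P \<subseteq> J \<cdot> P"
  shows "I_prime R J P"
  using assms unfolding I_prime_def by blast

text \<open>
  Adding \<open>p\<close> to the factor \<open>y\<close> changes neither the membership of the product in \<open>P\<close> nor the
  failure of both factors to lie in \<open>P\<close>, so both products must lie in \<open>I \<cdot> P\<close>.
\<close>

lemma I_prime_shift:
  assumes P: "I_prime R I P" and I: "ideal I R"
    and x: "x \<in> carrier R" "x \<notin> P" and y: "y \<in> carrier R" "y \<notin> P"
    and xy: "x \<otimes> y \<in> P" and p: "p \<in> P"
  shows "x \<otimes> p \<in> I \<cdot> P"
proof -
  have idP: "ideal P R" using P unfolding I_prime_def by blast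
  interpret P: ideal P R by fact
  interpret IP: ideal "I \<cdot> P" R by (rule ideal_prod_is_ideal[OF I idP])
  have pc: "p \<in> carrier R" using p by (rule P.Icarr)
  have prime: "u \<otimes> v \<in> I \<cdot> P"
    if "u \<in> carrier R" "v \<in> carrier R" "u \<otimes> v \<in> P" "u \<notin> P" "v \<notin> P" for u v
    using P that unfolding I_prime_def by blast
  have "y \<oplus> p \<notin> P"
  proof
    assume "y \<oplus> p \<in> P"
    then have "(y \<oplus> p) \<oplus> \<ominus> p \<in> P" using p by blast
    moreover have "(y \<oplus> p) \<oplus> \<ominus> p = y" using y pc by algebra
    ultimately show False using y by simp
  qed
  moreover have "x \<otimes> (y \<oplus> p) \<in> P"
    using x y pc xy P.I_l_closed[OF p x(1)] by (simp add: r_distr)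
  ultimately have "x \<otimes> (y \<oplus> p) \<in> I \<cdot> P"
    using prime x y pc by simp
  moreover have "x \<otimes> y \<in> I \<cdot> P" using prime x y xy by simp
  ultimately have "x \<otimes> (y \<oplus> p) \<oplus> \<ominus> (x \<otimes> y) \<in> I \<cdot> P" by blast
  moreover have "x \<otimes> (y \<oplus> p) \<oplus> \<ominus> (x \<otimes> y) = x \<otimes> p" using x y pc by algebra
  ultimately show ?thesis by simp
qed

lemma I_prime_not_primeE:
  assumes "I_prime R I P" "\<not> primeideal P R"
  obtains x y where "x \<in> carrier R" "x \<notin> P" "y \<in> carrier R" "y \<notin> P" "x \<otimes> y \<in> P"
proof -
  have "ideal P R" "carrier R \<noteq> P" using assms(1) unfolding I_prime_def by auto
  then show thesis using primeidealI[OF _ is_cring] assms(2) that by blast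
qed

text \<open>
  If \<open>x, y\<close> witness that \<open>P\<close> is not prime, so do \<open>x \<oplus> p, y\<close>. The shift, applied to both
  pairs with \<open>q\<close>, puts \<open>x \<otimes> q\<close> and \<open>(x \<oplus> p) \<otimes> q\<close> in \<open>I \<cdot> P\<close>; their difference is \<open>p \<otimes> q\<close>.
\<close>

lemma I_prime_not_prime_square:
  assumes P: "I_prime R I P" "\<not> primeideal P R" and I: "ideal I R"
    and p: "p \<in> P" and q: "q \<in> P"
  shows "p \<otimes> q \<in> I \<cdot> P"
proof -
  have idP: "ideal P R" using P unfolding I_prime_def by blast
  interpret P: ideal P R by fact
  interpret IP: ideal "I \<cdot> P" R by (rule ideal_prod_is_ideal[OF I idP])
  obtain x y where x: "x \<in> carrier R" "x \<notin> P" and y: "y \<in> carrier R" "y \<notin> P"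
    and xy: "x \<otimes> y \<in> P"
    using I_prime_not_primeE[OF P] by blast
  have pc: "p \<in> carrier R" "q \<in> carrier R" using p q by auto
  have "x \<oplus> p \<notin> P"
  proof
    assume "x \<oplus> p \<in> P"
    then have "(x \<oplus> p) \<oplus> \<ominus> p \<in> P" using p by blast
    moreover have "(x \<oplus> p) \<oplus> \<ominus> p = x" using x pc by algebra
    ultimately show False using x by simp
  qed
  moreover have "(x \<oplus> p) \<otimes> y \<in> P"
    using x y pc xy P.I_r_closed[OF p y(1)] by (simp add: l_distr)
  ultimately have "(x \<oplus> p) \<otimes> q \<in> I \<cdot> P"
    using I_prime_shift[OF P(1) I _ _ y _ q] x pc by simp
  moreover have "x \<otimes> q \<in> I \<cdot> P" using I_prime_shift[OF P(1) I x y xy q] .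
  ultimately have "(x \<oplus> p) \<otimes> q \<oplus> \<ominus> (x \<otimes> q) \<in> I \<cdot> P" by blast
  moreover have "(x \<oplus> p) \<otimes> q \<oplus> \<ominus> (x \<otimes> q) = p \<otimes> q" using x pc by algebra
  ultimately show ?thesis by simp
qed

text \<open>
  A factor \<open>x\<close> that witnesses the failure of primeness satisfies \<open>x \<otimes> a = r \<otimes> a \<otimes> a\<close>, so it agrees with \<open>r \<otimes> a\<close> up to an
  annihilator of \<open>a\<close>.
\<close>

lemma I_prime_cgenideal_imp_primeideal:
  assumes a: "a \<in> carrier R" and ann: "annihilator R a \<subseteq> PIdl a"
    and I: "ideal I R" and sq: "I \<cdot> (PIdl a) \<subseteq> PIdl (a [^] (2::nat))"
    and P: "I_prime R I (PIdl a)"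
  shows "primeideal (PIdl a) R"
proof (rule ccontr)
  assume "\<not> primeideal (PIdl a) R"
  then obtain x y where x: "x \<in> carrier R" "x \<notin> PIdl a"
    and y: "y \<in> carrier R" "y \<notin> PIdl a" and xy: "x \<otimes> y \<in> PIdl a"
    using I_prime_not_primeE[OF P] by blast
  interpret P: ideal "PIdl a" R by (rule cgenideal_ideal[OF a])
  have "x \<otimes> a \<in> PIdl (a [^] (2::nat))"
    using I_prime_shift[OF P I x y xy cgenideal_self[OF a]] sq by blast
  then obtain r where r: "r \<in> carrier R" "x \<otimes> a = r \<otimes> (a \<otimes> a)"
    using cgenideal_mem_iff a by (metis numeral_2_eq_2 nat_pow_Suc nat_pow_0 l_one)
  have "(x \<ominus> r \<otimes> a) \<otimes> a = x \<otimes> a \<ominus> r \<otimes> (a \<otimes> a)" using x r(1) a by algebra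
  also have "\<dots> = \<zero>" using r a by simp
  finally have "x \<ominus> r \<otimes> a \<in> PIdl a"
    using ann x r a unfolding annihilator_def by auto
  moreover have "r \<otimes> a \<in> PIdl a" using r cgenideal_mem_iff by metis
  ultimately have "(x \<ominus> r \<otimes> a) \<oplus> r \<otimes> a \<in> PIdl a" by blast
  moreover have "(x \<ominus> r \<otimes> a) \<oplus> r \<otimes> a = x" using x r a by algebra
  ultimately show False using x by simp
qed

section \<open>Quasi-local rings\<close>

text \<open>Zorn's lemma, applied to the ideals that contain \<open>J\<close> and avoid \<open>\<one>\<close>.\<close>

lemma proper_ideal_in_maximalideal:
  assumes J: "ideal J R" "J \<noteq> carrier R"
  obtains M where "maximalideal M R" "J \<subseteq> M"
proof -
  have proper: "K \<noteq> carrier R \<longleftrightarrow> \<one> \<notin> K" if "ideal K R" for K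
    using that ideal.one_imp_carrier one_closed by metis
  define A where "A = {K. ideal K R \<and> J \<subseteq> K \<and> \<one> \<notin> K}"
  have "J \<in> A" using J proper unfolding A_def by blast
  have "\<exists>M\<in>A. \<forall>K\<in>A. M \<subseteq> K \<longrightarrow> K = M"
  proof (rule subset_Zorn_nonempty)
    show "A \<noteq> {}" using \<open>J \<in> A\<close> by blast
    fix C assume C: "C \<noteq> {}" "subset.chain A C"
    then have "subset.chain {K. ideal K R} C"
      unfolding subset_chain_def A_def by blast
    then have "ideal (\<Union>C) R" using chain_Union_is_ideal[of C] C(1) by simp
    then show "\<Union>C \<in> A" using C unfolding subset_chain_def A_def by blast
  qed
  then obtain M where M: "M \<in> A" "\<And>K. K \<in> A \<Longrightarrow> M \<subseteq> K \<Longrightarrow> K = M" by blast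
  have "maximalideal M R"
  proof (rule maximalidealI)
    show "ideal M R" using M(1) unfolding A_def by blast
    then show "carrier R \<noteq> M" using M(1) proper unfolding A_def by blast
    fix K assume K: "ideal K R" "M \<subseteq> K"
    then show "K = M \<or> K = carrier R"
      using M proper[OF K(1)] unfolding A_def by blast
  qed
  then show ?thesis using that M(1) unfolding A_def by blast
qed

end

context quasi_local
begin

lemma nonunit_in_maximal:
  assumes "x \<in> carrier R" "x \<notin> Units R"
  shows "x \<in> m"
proof -
  obtain M where "maximalideal M R" "PIdl x \<subseteq> M"
    using proper_ideal_in_maximalideal[OF cgenideal_ideal cgenideal_proper] assms by blast
  then show ?thesis using unique_maximal cgenideal_self[OF assms(1)] by blast
qed

text \<open>If \<open>j\<close> lies in \<open>m\<close> then \<open>\<one> \<ominus> j\<close> does not, so it is a unit; and it kills \<open>x\<close>.\<close>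

lemma fixed_by_maximal_imp_zero:
  assumes j: "j \<in> m" and x: "x \<in> carrier R" and eq: "x = j \<otimes> x"
  shows "x = \<zero>"
proof -
  have jc: "j \<in> carrier R" using j by (rule Icarr)
  have "\<one> \<ominus> j \<notin> m"
  proof
    assume "\<one> \<ominus> j \<in> m"
    then have "(\<one> \<ominus> j) \<oplus> j \<in> m" using j by blast
    moreover have "(\<one> \<ominus> j) \<oplus> j = \<one>" using jc by algebra
    ultimately show False using one_imp_carrier I_notcarr by simp
  qed
  then have u: "\<one> \<ominus> j \<in> Units R" using nonunit_in_maximal jc by blast
  have "(\<one> \<ominus> j) \<otimes> x = x \<ominus> j \<otimes> x" using jc x by algebra
  also have "\<dots> = \<zero>" using eq x by simp
  finally have "(\<one> \<ominus> j) \<otimes> x = (\<one> \<ominus> j) \<otimes> \<zero>" using jc by simp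
  then show ?thesis using Units_l_cancel[OF u x] by simp
qed

text \<open>
  If \<open>(a)\<close> is \<open>I\<close>-prime but not prime, the square of \<open>a\<close> is a multiple of its cube, hence zero, and then
  \<open>I \<cdot> (PIdl a)\<close> vanishes.
\<close>

lemma I_prime_cgenideal_iff_zero_prime:
  assumes a: "a \<in> carrier R" "a \<notin> Units R"
    and I: "ideal I R" and cube: "I \<cdot> (PIdl a) \<subseteq> PIdl (a [^] (3::nat))"
  shows "I_prime R I (PIdl a) \<longleftrightarrow> I_prime R {\<zero>} (PIdl a)"
proof
  have idP: "ideal (PIdl a) R" using a by (simp add: cgenideal_ideal)
  interpret IP: ideal "I \<cdot> (PIdl a)" R by (rule ideal_prod_is_ideal[OF I idP])
  show "I_prime R I (PIdl a)" if "I_prime R {\<zero>} (PIdl a)"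
    using I_prime_mono[OF that] zero_ideal_prod[OF idP] by simp
  assume P: "I_prime R I (PIdl a)"
  have pow: "a [^] (3::nat) = a \<otimes> (a \<otimes> a)"
    using a by (simp add: numeral_3_eq_3 m_assoc)
  show "I_prime R {\<zero>} (PIdl a)"
  proof (cases "primeideal (PIdl a) R")
    case True
    then show ?thesis by (rule primeideal_imp_I_prime)
  next
    case False
    have "a \<otimes> a \<in> I \<cdot> (PIdl a)"
      using I_prime_not_prime_square[OF P False I] cgenideal_self a by blast
    then obtain u where u: "u \<in> carrier R" "a \<otimes> a = u \<otimes> (a \<otimes> (a \<otimes> a))"
      using cube cgenideal_mem_iff pow by (metis subsetD)
    have "u \<otimes> a \<in> m" using I_l_closed[OF nonunit_in_maximal[OF a] u(1)] .
    moreover have "a \<otimes> a = (u \<otimes> a) \<otimes> (a \<otimes> a)" using u a by (simp add: m_assoc)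
    ultimately have "a \<otimes> a = \<zero>" using fixed_by_maximal_imp_zero a by blast
    then have "I \<cdot> (PIdl a) \<subseteq> {\<zero>}"
      using cube pow a by (auto simp: cgenideal_def)
    then show ?thesis using I_prime_mono[OF P] zero_ideal_prod[OF idP] by simp
  qed
qed

text \<open>
  For nonzero \<open>a\<close>, irreducibility is the test of \<open>m\<close>-primeness at the product \<open>a\<close> itself, which
  lies outside \<open>m \<cdot> (PIdl a)\<close> since \<open>a\<close> is not fixed by any element of \<open>m\<close>. For \<open>a = \<zero>\<close> the
  ideal is \<open>m\<close>-prime in every quasi-local ring, while irreducibility of \<open>\<zero>\<close> means that there
  are no nonzero zero divisors.
\<close>

lemma maximal_prime_cgenideal_imp_irreducible_element:
  assumes a: "a \<in> carrier R" "a \<notin> Units R" and dom: "a = \<zero> \<longrightarrow> domain R"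
    and P: "I_prime R m (PIdl a)"
  shows "irreducible_element R a"
  unfolding irreducible_element_def
proof (intro conjI ballI impI a)
  fix x y assume x: "x \<in> carrier R" and y: "y \<in> carrier R" and axy: "a = x \<otimes> y"
  show "x \<in> PIdl a \<or> y \<in> PIdl a"
  proof (cases "a = \<zero>")
    case True
    then have "x = \<zero> \<or> y = \<zero>"
      using dom domain.integral x y axy by metis
    then show ?thesis using True cgenideal_self[OF a(1)] by blast
  next
    case False
    then have "a \<notin> m \<cdot> (PIdl a)"
      using fixed_by_maximal_imp_zero a ideal_prod_cgenideal[OF is_ideal a(1)] by blast
    then show ?thesis
      using P x y axy cgenideal_self[OF a(1)] unfolding I_prime_def by blast
  qed
qed

text \<open>
  A product in \<open>PIdl a\<close> outside \<open>m \<cdot> (PIdl a)\<close> is a unit multiple of \<open>a\<close>; moving the unit to one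
  factor turns it into a factorization of \<open>a\<close>.
\<close>

lemma irreducible_element_imp_maximal_prime_cgenideal:
  assumes irr: "irreducible_element R a"
  shows "I_prime R m (PIdl a)"
  unfolding I_prime_def
proof (intro conjI ballI impI)
  have a: "a \<in> carrier R" "a \<notin> Units R" using irr unfolding irreducible_element_def by auto
  show "ideal (PIdl a) R" using a by (simp add: cgenideal_ideal)
  then interpret P: ideal "PIdl a" R .
  show "PIdl a \<noteq> carrier R" using cgenideal_proper[OF a] .
  fix x y assume x: "x \<in> carrier R" and y: "y \<in> carrier R"
    and xy: "x \<otimes> y \<in> PIdl a - m \<cdot> (PIdl a)"
  then obtain r where r: "r \<in> carrier R" "x \<otimes> y = r \<otimes> a"
    using cgenideal_mem_iff by (metis DiffD1)
  have "r \<notin> m" using xy r ideal_prod_cgenideal[OF is_ideal a(1)] by auto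
  then have u: "r \<in> Units R" using nonunit_in_maximal r by blast
  have rx: "r \<otimes> (inv r \<otimes> x) = x" using u x r by (simp add: m_assoc[symmetric])
  have "a = inv r \<otimes> (r \<otimes> a)" using u a r by (simp add: m_assoc[symmetric])
  also have "\<dots> = (inv r \<otimes> x) \<otimes> y" using r u x y by (simp add: m_assoc flip: r(2))
  finally have "inv r \<otimes> x \<in> PIdl a \<or> y \<in> PIdl a"
    using irr u x y unfolding irreducible_element_def by blast
  then show "x \<in> PIdl a \<or> y \<in> PIdl a"
    using P.I_l_closed[OF _ r(1)] rx by metis
qed

end

section \<open>The three characterizations\<close>

theorem theorem2p11:
  fixes R :: "('a, 'b) ring_scheme" (structure) and a :: 'a
  assumes "cring R" and "a \<in> carrier R" and "a \<notin> Units R"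
  shows
    "(annihilator R a \<subseteq> PIdl a \<longrightarrow>
       (\<forall>I. ideal I R \<and> I \<cdot> (PIdl a) \<subseteq> (PIdl a) [^]\<^bsub>ideals_set R\<^esub> (2::nat) \<longrightarrow>
          (I_prime R I (PIdl a) \<longleftrightarrow> primeideal (PIdl a) R)))
     \<and> (\<forall>m. quasi_local R m \<longrightarrow>
       (\<forall>I. ideal I R \<and> I \<cdot> (PIdl a) \<subseteq> (PIdl a) [^]\<^bsub>ideals_set R\<^esub> (3::nat) \<longrightarrow>
          (I_prime R I (PIdl a) \<longleftrightarrow> I_prime R {\<zero>} (PIdl a))))
     \<and> (\<forall>m. quasi_local R m \<longrightarrow> (a = \<zero> \<longrightarrow> domain R) \<longrightarrow>
       (I_prime R m (PIdl a) \<longleftrightarrow> irreducible_element R a))"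
proof -
  interpret cring R by fact
  have "I_prime R I (PIdl a) \<longleftrightarrow> primeideal (PIdl a) R"
    if "annihilator R a \<subseteq> PIdl a" "ideal I R" "I \<cdot> (PIdl a) \<subseteq> PIdl (a [^] (2::nat))" for I
    using I_prime_cgenideal_imp_primeideal[OF assms(2) that] primeideal_imp_I_prime by blast
  moreover have "I_prime R I (PIdl a) \<longleftrightarrow> I_prime R {\<zero>} (PIdl a)"
    if "quasi_local R m" "ideal I R" "I \<cdot> (PIdl a) \<subseteq> PIdl (a [^] (3::nat))" for m I
    using quasi_local.I_prime_cgenideal_iff_zero_prime[OF that(1) assms(2,3) that(2,3)] .
  moreover have "I_prime R m (PIdl a) \<longleftrightarrow> irreducible_element R a"
    if "quasi_local R m" "a = \<zero> \<longrightarrow> domain R" for m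
    using quasi_local.maximal_prime_cgenideal_imp_irreducible_element[OF that(1) assms(2,3) that(2)]
      quasi_local.irreducible_element_imp_maximal_prime_cgenideal[OF that(1)] by blast
  ultimately show ?thesis
    unfolding cgenideal_power[OF assms(2)] by simp
qed

end
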